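(* Let $n \ge 1$ and $0 \le \tau \le n-1$ be integers, and let $\{p(\tau)\}_n$ denote the number of partitions of $n$ whose largest part equals $n-\tau$. Set $\lambda = 2\tau - n$ if $2\tau - n > 0$ and $\lambda = 0$ if $2\tau - n \le 0$. Then $$\{p(\tau)\}_n \;=\; p(\tau) \;-\; \sum_{i=0}^{\lambda-1} \{p(i)\}_{\tau},$$ where the sum is empty when $\lambda = 0$. In other words, the term $\{p(\tau)\}_n$ has exactly $\lambda = \max(2\tau-n,0)$ subtracted terms, namely $\{p(0)\}_\tau, \{p(1)\}_\tau, \dots, \{p(\lambda-1)\}_\tau$.
   Context: $p(m)$ denotes the number of partitions of the integer $m$, with the conventions $p(0)=1$ and $p(m)=0$ for $m<0$. The paper writes $p(n)=\sum_{i=0}^{n-1}\{p(i)\}$, where the term $\{p(i)\}$ is the number of partitions of $n$ whose largest part is $n-i$. In the paper's terminology, $\{p(\tau)\}$ is a "parcel" whose "father-parcel" is $p(n)$. The parcel is written as $p(\tau)$ minus its "child-parcels" $\{p(0)\},\dots,\{p(\lambda-1)\}$, and each child-parcel $\{p(i)\}$ is taken relative to $\tau$, i.e. it is the number of partitions of $\tau$ whose largest part is $\tau-i$. This rigorous reading of the paper's informal parcel/cell statement is the one confirmed by the paper's worked expansion of $p(10)$. *)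

theory Defs
  imports Complex_Main "HOL-Library.Multiset"
begin

text \<open>
  The argument is an integer, so that the convention \<open>p(m) = 0\<close> for \<open>m < 0\<close>
  is covered (there are no such partitions) and no truncated subtraction occurs.
\<close>

definition partitions :: "int \<Rightarrow> nat multiset set" where
  "partitions m = {A. 0 \<notin># A \<and> int (sum_mset A) = m}"

definition num_partitions :: "int \<Rightarrow> nat" where
  "num_partitions m = card (partitions m)"

text \<open>
  \<open>parcel n t\<close> is \<open>{p(t)}\<^sub>n\<close>, the number of partitions of \<open>n\<close> with largest part \<open>n - t\<close>.
  The empty partition has no largest part (\<open>Max\<close> is unspecified on it), hence it is excluded.
\<close>

definition parcel :: "int \<Rightarrow> int \<Rightarrow> nat" where
  "parcel n t = card {A \<in> partitions n. A \<noteq> {#} \<and> int (Max (set_mset A)) = n - t}"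

lemma finite_partitions: "finite (partitions m)"
proof -
  have size_le: "size A \<le> sum_mset A" if "0 \<notin># A" for A :: "nat multiset"
    using that by (induction A) auto
  have "partitions m \<subseteq> mset ` {xs. set xs \<subseteq> {..nat m} \<and> length xs \<le> nat m}"
  proof
    fix A assume "A \<in> partitions m"
    hence A: "0 \<notin># A" "sum_mset A = nat m" by (auto simp: partitions_def simp del: of_nat_sum_mset)
    obtain xs where xs: "mset xs = A" using ex_mset by blast
    have "x \<le> nat m" if "x \<in># A" for x
      using that A(2) by (metis le_add1 multi_member_split sum_mset.add_mset)
    hence "set xs \<subseteq> {..nat m}" using xs by auto
    moreover have "length xs \<le> nat m" using size_le[OF A(1)] A(2) xs by auto
    ultimately show "A \<in> mset ` {xs. set xs \<subseteq> {..nat m} \<and> length xs \<le> nat m}"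
      using xs by blast
  qed
  thus ?thesis
    by (rule finite_subset) (intro finite_imageI finite_lists_length_le finite_atMost)
qed

lemma num_partitions_neg: "m < 0 \<Longrightarrow> num_partitions m = 0"
  proof -
  assume "m < 0"
  hence "partitions m = {}" by (auto simp: partitions_def simp del: of_nat_sum_mset)
  thus ?thesis by (simp add: num_partitions_def)
qed

lemma num_partitions_0: "num_partitions 0 = 1"
proof -
  have "A = {#}" if "0 \<notin># A" "sum_mset A = 0" for A :: "nat multiset"
    using that by (cases A) auto
  hence "partitions 0 = {{#}}" by (auto simp: partitions_def simp del: of_nat_sum_mset sum_mset_0_iff)
  thus ?thesis by (simp add: num_partitions_def)
qed

end

theory Submission
  imports Defs
begin

text \<open>
  Removing one copy of the largest part \<open>n - \<tau>\<close> turns the partitions counted by \<open>{p(\<tau>)}\<^sub>n\<close>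
  into the partitions of \<open>\<tau>\<close> with all parts at most \<open>n - \<tau>\<close>. The remaining partitions of \<open>\<tau>\<close>
  have a largest part \<open>\<tau> - i > n - \<tau>\<close>, that is, \<open>0 \<le> i < 2\<tau> - n\<close>, and are classified by \<open>i\<close>.
\<close>

lemma partitions_iff: "A \<in> partitions m \<longleftrightarrow> 0 \<notin># A \<and> int (sum_mset A) = m"
  by (simp only: partitions_def mem_Collect_eq)

lemma add_mset_in_partitions_iff:
  "add_mset k A \<in> partitions m \<longleftrightarrow> k > 0 \<and> A \<in> partitions (m - int k)"
  by (auto simp: partitions_iff simp del: of_nat_sum_mset)

lemma partition_part_le:
  assumes "A \<in> partitions m" and "x \<in># A"
  shows "int x \<le> m"
proof -
  from assms(2) obtain B where "A = add_mset x B" by (rule mset_add)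
  with assms(1) show ?thesis by (auto simp: partitions_iff simp del: of_nat_sum_mset)
qed

text \<open>The injective map \<open>add_mset k\<close> with \<open>k = n - t\<close> is a bijection
  between the two sets of multisets. Since \<open>t < n\<close>, \<open>k\<close> is positive, so
  the map never inserts a forbidden part 0.\<close>

lemma parcel_eq_card_bounded_partitions:
  assumes "t < n"
  shows "parcel n t = card {A \<in> partitions t. \<forall>x\<in>#A. int x \<le> n - t}"
proof -
  define k where "k = nat (n - t)"
  have k: "int k = n - t" "k > 0" using assms by (auto simp: k_def)
  have "{A \<in> partitions n. A \<noteq> {#} \<and> int (Max (set_mset A)) = n - t} =
        add_mset k ` {A \<in> partitions t. \<forall>x\<in>#A. int x \<le> n - t}" (is "?L = ?R")
  proof (intro equalityI subsetI)
    fix A assume A: "A \<in> ?L"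
    then have mx: "Max (set_mset A) = k" and "A \<noteq> {#}" using k by auto
    then have "k \<in># A" using Max_in[of "set_mset A"] by simp
    then obtain B where B: "A = add_mset k B" by (rule mset_add)
    \<comment> \<open>Only one copy of \<open>k\<close> was removed, so \<open>k\<close> may still
      occur in \<open>B\<close> and the bound is not strict.\<close>
    have "x \<le> k" if "x \<in># B" for x
      using that B Max_ge[of "set_mset A" x] unfolding mx by simp
    moreover have "B \<in> partitions t"
      using A B k by (simp add: add_mset_in_partitions_iff)
    ultimately have "B \<in> {A \<in> partitions t. \<forall>x\<in>#A. int x \<le> n - t}"
      by (simp flip: k(1))
    with B show "A \<in> ?R" by blast
  next
    fix A assume "A \<in> ?R"
    then obtain B where B: "A = add_mset k B" "B \<in> partitions t" "\<forall>x\<in>#B. int x \<le> int k"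
      using k by auto
    then have "Max (set_mset A) = k" by (intro Max_eqI) auto
    with B k show "A \<in> ?L" by (simp add: add_mset_in_partitions_iff)
  qed
  then show ?thesis by (simp add: parcel_def card_image inj_on_def)
qed

theorem mainTheorem1:
  fixes n \<tau> lam :: int
  assumes "n \<ge> 1" and "0 \<le> \<tau>" and "\<tau> \<le> n - 1"
    and "lam = (if 2 * \<tau> - n > 0 then 2 * \<tau> - n else 0)"
  shows "int (parcel n \<tau>) = int (num_partitions \<tau>) - (\<Sum>i = 0..lam - 1. int (parcel \<tau> i))"
proof -
  define S where "S i = {A \<in> partitions \<tau>. A \<noteq> {#} \<and> int (Max (set_mset A)) = \<tau> - i}" for i
  define B where "B = {A \<in> partitions \<tau>. \<forall>x\<in>#A. int x \<le> n - \<tau>}"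
  have fin: "finite (S i)" "finite B" for i
    using finite_partitions[of \<tau>] by (auto simp: S_def B_def)
  have large: "A \<in> partitions \<tau> - B \<longleftrightarrow> (\<exists>i\<in>{0..lam - 1}. A \<in> S i)" for A
  proof
    assume A: "A \<in> partitions \<tau> - B"
    then obtain x where x: "x \<in># A" "int x > n - \<tau>" by (auto simp: B_def)
    then have "A \<noteq> {#}" "x \<le> Max (set_mset A)" by auto
    moreover from \<open>A \<noteq> {#}\<close> have "int (Max (set_mset A)) \<le> \<tau>"
      using A by (intro partition_part_le[of A]) auto
    moreover from x(2) \<open>x \<le> Max (set_mset A)\<close> have "n - \<tau> < int (Max (set_mset A))"
      by linarith
    \<comment> \<open>The maximum M satisfies \<open>n - \<tau>\<close> < M \<le>
      \<open>\<tau>\<close>. This forces \<open>2 * \<tau> - n > 0\<close>, so \<open>lam\<close> is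
      \<open>2 * \<tau> - n\<close> and the index \<open>\<tau>\<close> - M lies in 0, ...,
      \<open>lam - 1\<close>.\<close>
    ultimately have "\<tau> - int (Max (set_mset A)) \<in> {0..lam - 1}"
      using assms(4) by simp
    moreover have "A \<in> S (\<tau> - int (Max (set_mset A)))"
      using A \<open>A \<noteq> {#}\<close> by (simp add: S_def)
    ultimately show "\<exists>i\<in>{0..lam - 1}. A \<in> S i" by blast
  next
    assume "\<exists>i\<in>{0..lam - 1}. A \<in> S i"
    then obtain i where i: "0 \<le> i" "i < lam" "A \<in> S i" by auto
    then have "Max (set_mset A) \<in># A" by (intro Max_in) (auto simp: S_def)
    \<comment> \<open>From 0 \<le> \<open>i\<close> < \<open>lam\<close> the case
      \<open>lam = 0\<close> is excluded, hence \<open>\<tau> - i > n - \<tau>\<close>.\<close>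
    moreover have "int (Max (set_mset A)) > n - \<tau>"
      using i assms(4) by (auto simp: S_def split: if_splits)
    ultimately have "A \<notin> B" unfolding B_def using linorder_not_less by blast
    then show "A \<in> partitions \<tau> - B" using i(3) by (simp add: S_def)
  qed
  have "card (partitions \<tau> - B) = card (\<Union>i\<in>{0..lam - 1}. S i)"
    using large by (intro arg_cong[where f = card]) blast
  \<comment> \<open>The classes are disjoint because the largest part of a partition determines
    \<open>i\<close>.\<close>
  also have "\<dots> = (\<Sum>i = 0..lam - 1. card (S i))"
    using fin by (intro card_UN_disjoint) (auto simp: S_def)
  finally have "card (partitions \<tau> - B) = (\<Sum>i = 0..lam - 1. parcel \<tau> i)"
    by (simp add: parcel_def S_def)
  \<comment> \<open>Counting stays additive over the naturals; the subtraction is made only after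
    passing to integers, so nothing is truncated.\<close>
  moreover have "card (partitions \<tau> - B) + card B = num_partitions \<tau>"
  proof -
    have "B \<subseteq> partitions \<tau>" by (auto simp: B_def)
    then show ?thesis
      by (simp add: num_partitions_def card_Diff_subset fin card_mono finite_partitions)
  qed
  moreover have "card B = parcel n \<tau>"
    using parcel_eq_card_bounded_partitions[of \<tau> n] assms(3) by (simp add: B_def)
  ultimately have "(\<Sum>i = 0..lam - 1. parcel \<tau> i) + parcel n \<tau> = num_partitions \<tau>" by simp
  then have "int (num_partitions \<tau>) = (\<Sum>i = 0..lam - 1. int (parcel \<tau> i)) + int (parcel n \<tau>)"
    by (metis of_nat_add of_nat_sum)
  then show ?thesis by simp
qed

end
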